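(* Let $\mathbb{X},\mathbb{E}$ be finite-dimensional Euclidean spaces, $\Phi:\mathbb{X}\to\mathbb{E}$ a linear operator, and $g:\mathbb{X}\to\mathbb{R}\cup\{\infty\}$ a proper lower semicontinuous convex function. For $(b,\mu)\in\mathbb{E}\times(0,\infty)$ consider the problem $$P(b,\mu):\quad\min_{x\in\mathbb{X}}\ \tfrac{1}{2\mu}\|\Phi x-b\|^2+g(x),$$ and let $S_{LS}(b,\mu)$ be its set of optimal solutions. Let $(\bar b,\bar\mu)\in\mathbb{E}\times(0,\infty)$ and let $\bar x$ be an optimal solution of $P(\bar b,\bar\mu)$. If $g$ satisfies the quadratic growth condition at $\bar x$ for $\bar y:=-\frac1{\bar\mu}\Phi^*(\Phi\bar x-\bar b)$, then the following are equivalent: (i) the solution mapping $S_{LS}$ has the isolated calmness property at $(\bar b,\bar\mu)$ for $\bar x$; (ii) $\bar x$ is the strong solution of problem $P(\bar b,\bar\mu)$; (iii) $\mathrm{Ker}\,\Phi\cap T_{\partial g^*(\bar y)}(\bar x)=\{0\}$.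
   Context: $g^*$ is the Fenchel conjugate of $g$ and $\partial$ the convex subdifferential. Tangent cone: $T_\Omega(\bar u):=\{w\mid\exists\,t_k\downarrow0,\ w_k\to w,\ \bar u+t_kw_k\in\Omega\}$ for $\bar u\in\Omega$. Isolated calmness: $S_{LS}$ is isolated calm at $(\bar b,\bar\mu)$ for $\bar x\in S_{LS}(\bar b,\bar\mu)$ if there exist $\kappa>0$ and neighborhoods $U$ of $\bar x$, $V$ of $\bar b$, and $M\subset(0,\infty)$ of $\bar\mu$ such that $\|x-\bar x\|\le\kappa(\|b-\bar b\|+|\mu-\bar\mu|)$ whenever $(b,\mu)\in V\times M$ and $x\in S_{LS}(b,\mu)\cap U$. Strong solution (of order 2): $\bar x$ is a strong solution of minimizing a function $\psi$ if there exist $c,\varepsilon>0$ such that $\psi(x)\ge\psi(\bar x)+\frac c2\|x-\bar x\|^2$ for all $x$ with $\|x-\bar x\|<\varepsilon$. Quadratic growth condition: a proper lower semicontinuous convex function $\varphi$ satisfies it at $\bar u\in\mathrm{dom}\,\varphi$ for $\bar v\in\partial\varphi(\bar u)$ if there exist $c,\varepsilon>0$ such that $\varphi(u)\ge\varphi(\bar u)+\langle\bar v,u-\bar u\rangle+\frac c2[d(u;(\partial\varphi)^{-1}(\bar v))]^2$ for all $u$ with $\|u-\bar u\|<\varepsilon$, where $d(\cdot;\Omega)$ is the distance to $\Omega$. *)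

theory Defs
  imports "HOL-Analysis.Analysis"
begin

text \<open>
  Functions into \<open>\<real> \<union> {\<infinity>}\<close> are rendered as functions into \<^typ>\<open>ereal\<close>; the value \<open>-\<infinity>\<close> is
  excluded by properness.
\<close>

definition proper_fun :: "('a \<Rightarrow> ereal) \<Rightarrow> bool" where
  "proper_fun \<phi> \<longleftrightarrow> (\<forall>x. \<phi> x \<noteq> -\<infinity>) \<and> (\<exists>x. \<phi> x \<noteq> \<infinity>)"

definition lsc_fun :: "('a::topological_space \<Rightarrow> ereal) \<Rightarrow> bool" where
  "lsc_fun \<phi> \<longleftrightarrow> (\<forall>x. \<phi> x \<le> Liminf (nhds x) \<phi>)"

text \<open>The library's \<^const>\<open>convex_on\<close> only covers real-valued functions. In \<^typ>\<open>ereal\<close> one has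
  \<open>0 * \<infinity> = 0\<close>, so the endpoints \<open>u = 0\<close> and \<open>v = 0\<close> impose nothing.\<close>

definition convex_fun :: "('a::real_vector \<Rightarrow> ereal) \<Rightarrow> bool" where
  "convex_fun \<phi> \<longleftrightarrow> (\<forall>x y. \<forall>u\<ge>0. \<forall>v\<ge>0. u + v = 1 \<longrightarrow>
     \<phi> (u *\<^sub>R x + v *\<^sub>R y) \<le> ereal u * \<phi> x + ereal v * \<phi> y)"

definition fenchel_conjugate :: "('a::real_inner \<Rightarrow> ereal) \<Rightarrow> 'a \<Rightarrow> ereal" where
  "fenchel_conjugate \<phi> y = (SUP x. ereal (y \<bullet> x) - \<phi> x)"

text \<open>Empty at points where \<open>\<phi>\<close> is not finite.\<close>

definition subdifferential :: "('a::real_inner \<Rightarrow> ereal) \<Rightarrow> 'a \<Rightarrow> 'a set" where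
  "subdifferential \<phi> u =
     {v. \<bar>\<phi> u\<bar> \<noteq> \<infinity> \<and> (\<forall>x. \<phi> x \<ge> \<phi> u + ereal (v \<bullet> (x - u)))}"

definition tangent_cone :: "'a::real_normed_vector set \<Rightarrow> 'a \<Rightarrow> 'a set" where
  "tangent_cone \<Omega> u =
     {w. \<exists>(t :: nat \<Rightarrow> real) (ws :: nat \<Rightarrow> 'a). (\<forall>k. t k > 0) \<and> t \<longlonglongrightarrow> 0 \<and> ws \<longlonglongrightarrow> w \<and>
         (\<forall>k. u + t k *\<^sub>R ws k \<in> \<Omega>)}"

text \<open>Meant for \<open>v \<in> subdifferential \<phi> u\<close>. Then the set whose distance is taken contains \<open>u\<close>, so
  the convention that \<^const>\<open>infdist\<close> to the empty set is \<open>0\<close> plays no role.\<close>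

definition quadratic_growth :: "('a::real_inner \<Rightarrow> ereal) \<Rightarrow> 'a \<Rightarrow> 'a \<Rightarrow> bool" where
  "quadratic_growth \<phi> u v \<longleftrightarrow> (\<exists>c>0. \<exists>\<epsilon>>0. \<forall>x. norm (x - u) < \<epsilon> \<longrightarrow>
     \<phi> x \<ge> \<phi> u + ereal (v \<bullet> (x - u))
             + ereal (c / 2 * (infdist x {z. v \<in> subdifferential \<phi> z})\<^sup>2))"

definition strong_solution :: "('a::real_normed_vector \<Rightarrow> ereal) \<Rightarrow> 'a \<Rightarrow> bool" where
  "strong_solution \<psi> x\<^sub>0 \<longleftrightarrow> (\<exists>c>0. \<exists>\<epsilon>>0. \<forall>x. norm (x - x\<^sub>0) < \<epsilon> \<longrightarrow>
     \<psi> x \<ge> \<psi> x\<^sub>0 + ereal (c / 2 * (norm (x - x\<^sub>0))\<^sup>2))"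

definition LS_objective ::
  "('a \<Rightarrow> 'b::real_normed_vector) \<Rightarrow> ('a \<Rightarrow> ereal) \<Rightarrow> 'b \<Rightarrow> real \<Rightarrow> 'a \<Rightarrow> ereal" where
  "LS_objective \<Phi> g b \<mu> x = ereal (1 / (2 * \<mu>) * (norm (\<Phi> x - b))\<^sup>2) + g x"

definition S_LS ::
  "('a \<Rightarrow> 'b::real_normed_vector) \<Rightarrow> ('a \<Rightarrow> ereal) \<Rightarrow> 'b \<Rightarrow> real \<Rightarrow> 'a set" where
  "S_LS \<Phi> g b \<mu> = {x. is_arg_min (LS_objective \<Phi> g b \<mu>) (\<lambda>_. True) x}"

definition isolated_calm ::
  "('b::real_normed_vector \<Rightarrow> real \<Rightarrow> 'a::real_normed_vector set) \<Rightarrow> 'b \<Rightarrow> real \<Rightarrow> 'a \<Rightarrow> bool" where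
  "isolated_calm S b\<^sub>0 \<mu>\<^sub>0 x\<^sub>0 \<longleftrightarrow>
     (\<exists>\<kappa>>0. \<exists>U V M. open U \<and> x\<^sub>0 \<in> U \<and> open V \<and> b\<^sub>0 \<in> V \<and> open M \<and> \<mu>\<^sub>0 \<in> M \<and> M \<subseteq> {0<..} \<and>
        (\<forall>b\<in>V. \<forall>\<mu>\<in>M. \<forall>x \<in> S b \<mu> \<inter> U.
           norm (x - x\<^sub>0) \<le> \<kappa> * (norm (b - b\<^sub>0) + \<bar>\<mu> - \<mu>\<^sub>0\<bar>)))"

end

theory Submission
  imports Defs
begin

text \<open>
  The least squares term is quadratic, so with \<open>y = - (1 / \<mu>) \<Phi>\<^sup>* (\<Phi> x - b)\<close>, its negative gradient
  at \<open>x\<close>, the objective \<open>\<psi>\<close> satisfies the exact identity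
  \<open>\<psi> z - \<psi> x = (g z - g x - y \<bullet> (z - x)) + |\<Phi> (z - x)|\<^sup>2 / (2 \<mu>)\<close>.
  The bracket is the gap in the subgradient inequality. When \<open>y\<close> is a subgradient of \<open>g\<close> at \<open>x\<close>,
  which is Fermat's rule for a minimiser \<open>x\<close>, the gap is nonnegative and vanishes exactly on
  \<open>D = (\<partial>g)\<^sup>-\<^sup>1(y)\<close>. This set is \<open>\<partial>g\<^sup>*(y)\<close>
  (lemma \<open>subdifferential_fenchel_conjugate\<close>), so all three conditions speak about how \<open>\<Phi>\<close> acts
  on \<open>D\<close> near \<open>x\<close>.

  Isolated calmness and strong optimality each force an error bound
  \<open>|z - x| \<le> C |\<Phi> (z - x)|\<close> for \<open>z \<in> D\<close> near \<open>x\<close>. For a strong solution this is the identity with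
  zero gap. For calmness, every \<open>z \<in> D\<close> solves the problem whose datum is moved to
  \<open>b + \<Phi> (z - x)\<close>, because this keeps the residual and hence \<open>y\<close> unchanged. Along a tangent
  direction \<open>w\<close> of \<open>D\<close> the error bound becomes \<open>|w| \<le> C |\<Phi> w|\<close>, which excludes nonzero \<open>w\<close>
  in the kernel.

  Conversely, if \<open>x\<close> is not a strong solution, there are points tending to \<open>x\<close> at which both terms
  of the identity are of smaller order than the squared distance to \<open>x\<close>. By quadratic growth these
  points are then closer to \<open>D\<close> than to \<open>x\<close> by an order of magnitude, and a limit of the normalised
  displacements is a nonzero kernel vector tangent to \<open>D\<close>. Finally, strong solutions are calm since
  the difference of the two least squares terms is Lipschitz near \<open>x\<close> with a constant proportional
  to the size of the perturbation.
\<close>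

section \<open>Fermat's rule for the regularised least squares problem\<close>

lemma subdifferential_finite:
  assumes "v \<in> subdifferential \<phi> u"
  shows "\<bar>\<phi> u\<bar> \<noteq> \<infinity>"
  using assms by (simp add: subdifferential_def)

lemma subdifferential_ineq:
  assumes "v \<in> subdifferential \<phi> u"
  shows "\<phi> u + ereal (v \<bullet> (x - u)) \<le> \<phi> x"
  using assms by (simp add: subdifferential_def)

lemma norm_residual_expand:
  fixes \<Phi> :: "'a::euclidean_space \<Rightarrow> 'b::euclidean_space"
  assumes "linear \<Phi>"
  shows "1 / (2 * \<mu>) * (norm (\<Phi> z - b))\<^sup>2
       = 1 / (2 * \<mu>) * (norm (\<Phi> x - b))\<^sup>2
         - (- (1 / \<mu>) *\<^sub>R adjoint \<Phi> (\<Phi> x - b)) \<bullet> (z - x)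
         + 1 / (2 * \<mu>) * (norm (\<Phi> (z - x)))\<^sup>2"
proof -
  have "\<Phi> z - b = (\<Phi> x - b) + \<Phi> (z - x)"
    using assms by (simp add: linear_diff)
  then have "(norm (\<Phi> z - b))\<^sup>2
      = (norm (\<Phi> x - b))\<^sup>2 + 2 * ((\<Phi> x - b) \<bullet> \<Phi> (z - x)) + (norm (\<Phi> (z - x)))\<^sup>2"
    by (simp only: power2_norm_eq_inner) (simp add: inner_add inner_commute)
  moreover have "(\<Phi> x - b) \<bullet> \<Phi> (z - x) = adjoint \<Phi> (\<Phi> x - b) \<bullet> (z - x)"
    using adjoint_works[OF assms] by (simp add: inner_commute)
  ultimately have "(norm (\<Phi> z - b))\<^sup>2 = (norm (\<Phi> x - b))\<^sup>2
      + 2 * (adjoint \<Phi> (\<Phi> x - b) \<bullet> (z - x)) + (norm (\<Phi> (z - x)))\<^sup>2"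
    by simp
  then show ?thesis
    by (simp add: distrib_left)
qed

lemma LS_objective_expand:
  fixes \<Phi> :: "'a::euclidean_space \<Rightarrow> 'b::euclidean_space"
  assumes "linear \<Phi>" and "g x = ereal gx" and "g z = ereal gz"
    and "y = - (1 / \<mu>) *\<^sub>R adjoint \<Phi> (\<Phi> x - b)"
  shows "LS_objective \<Phi> g b \<mu> z = LS_objective \<Phi> g b \<mu> x
      + ereal (gz - gx - y \<bullet> (z - x) + 1 / (2 * \<mu>) * (norm (\<Phi> (z - x)))\<^sup>2)"
  using norm_residual_expand[OF assms(1), of \<mu> z b x] assms(2-4)
  by (simp add: LS_objective_def)

lemma is_arg_min_ereal_iff:
  fixes f :: "'a \<Rightarrow> ereal"
  shows "is_arg_min f (\<lambda>_. True) x \<longleftrightarrow> (\<forall>z. f x \<le> f z)"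
  by (auto simp: is_arg_min_def not_less)

lemma S_LS_iff: "x \<in> S_LS \<Phi> g b \<mu> \<longleftrightarrow> (\<forall>z. LS_objective \<Phi> g b \<mu> x \<le> LS_objective \<Phi> g b \<mu> z)"
  by (simp add: S_LS_def is_arg_min_ereal_iff)

lemma S_LS_le:
  assumes "x \<in> S_LS \<Phi> g b \<mu>"
  shows "LS_objective \<Phi> g b \<mu> x \<le> LS_objective \<Phi> g b \<mu> z"
  using assms by (simp add: S_LS_iff)

lemma S_LS_finite:
  assumes "proper_fun g" and "x \<in> S_LS \<Phi> g b \<mu>"
  shows "\<bar>g x\<bar> \<noteq> \<infinity>"
proof -
  obtain z where z: "g z \<noteq> \<infinity>" "g z \<noteq> -\<infinity>" "g x \<noteq> -\<infinity>"
    using assms(1) unfolding proper_fun_def by blast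
  moreover have "LS_objective \<Phi> g b \<mu> x \<le> LS_objective \<Phi> g b \<mu> z"
    using assms(2) by (rule S_LS_le)
  ultimately show ?thesis
    unfolding LS_objective_def by (cases "g x"; cases "g z") auto
qed

text \<open>
  Since \<open>g\<close> is merely convex, the necessity of the subgradient inequality comes from moving a
  fraction \<open>t\<close> of the way from \<open>x\<close> to \<open>z\<close>: the change of the smooth part is linear in \<open>t\<close> up to a
  term of order \<open>t\<^sup>2\<close>, which disappears after division by \<open>t\<close> and \<open>t \<rightarrow> 0\<close>.
\<close>

lemma S_LS_iff_subdifferential:
  fixes \<Phi> :: "'a::euclidean_space \<Rightarrow> 'b::euclidean_space"
  assumes lin: "linear \<Phi>" and proper: "proper_fun g" and conv: "convex_fun g" and mu: "\<mu> > 0"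
  shows "x \<in> S_LS \<Phi> g b \<mu> \<longleftrightarrow> - (1 / \<mu>) *\<^sub>R adjoint \<Phi> (\<Phi> x - b) \<in> subdifferential g x"
    (is "_ \<longleftrightarrow> ?v \<in> _")
proof
  assume x: "x \<in> S_LS \<Phi> g b \<mu>"
  then have fin: "\<bar>g x\<bar> \<noteq> \<infinity>" by (rule S_LS_finite[OF proper])
  then obtain gx where gx: "g x = ereal gx" by auto
  have "g x + ereal (?v \<bullet> (z - x)) \<le> g z" for z
  proof (cases "g z")
    case (real gz)
    define q where "q = 1 / (2 * \<mu>) * (norm (\<Phi> (z - x)))\<^sup>2"
    have ineq: "gx + ?v \<bullet> (z - x) \<le> gz + t * q" if t: "0 < t" "t \<le> 1" for t :: real
    proof -
      define p where "p = (1 - t) *\<^sub>R x + t *\<^sub>R z"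
      have px: "p - x = t *\<^sub>R (z - x)" by (simp add: p_def algebra_simps)
      have "g p \<le> ereal (1 - t) * g x + ereal t * g z"
        unfolding p_def using conv t unfolding convex_fun_def by simp
      then have gp: "g p \<le> ereal ((1 - t) * gx + t * gz)" by (simp add: gx real)
      have "LS_objective \<Phi> g b \<mu> x \<le> LS_objective \<Phi> g b \<mu> p"
        using x by (rule S_LS_le)
      also have "\<dots> \<le> ereal (1 / (2 * \<mu>) * (norm (\<Phi> p - b))\<^sup>2) + ereal ((1 - t) * gx + t * gz)"
        unfolding LS_objective_def using gp by (rule add_left_mono)
      finally have "1 / (2 * \<mu>) * (norm (\<Phi> x - b))\<^sup>2 + gx
          \<le> 1 / (2 * \<mu>) * (norm (\<Phi> p - b))\<^sup>2 + ((1 - t) * gx + t * gz)"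
        by (simp add: LS_objective_def gx)
      also have "1 / (2 * \<mu>) * (norm (\<Phi> p - b))\<^sup>2
          = 1 / (2 * \<mu>) * (norm (\<Phi> x - b))\<^sup>2 - t * (?v \<bullet> (z - x)) + t\<^sup>2 * q"
        unfolding norm_residual_expand[OF lin, of \<mu> p b x] px linear_scale[OF lin] q_def
        by (simp add: power_mult_distrib)
      finally have "t * (gx + ?v \<bullet> (z - x)) \<le> t * (gz + t * q)"
        by (simp add: algebra_simps power2_eq_square)
      then show ?thesis using t by simp
    qed
    have "((\<lambda>t. gz + t * q) \<longlongrightarrow> gz + 0 * q) (at_right 0)"
      by (intro tendsto_intros)
    moreover have "\<forall>\<^sub>F t in at_right (0::real). gx + ?v \<bullet> (z - x) \<le> gz + t * q"
      unfolding eventually_at_right_field using ineq by (intro exI[of _ 1]) auto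
    ultimately have "gx + ?v \<bullet> (z - x) \<le> gz + 0 * q"
      by (intro tendsto_lowerbound[where F = "at_right 0"]) auto
    then show ?thesis by (simp add: gx real)
  next
    case MInf
    then show ?thesis using proper by (simp add: proper_fun_def)
  qed simp
  with fin show "?v \<in> subdifferential g x"
    by (simp add: subdifferential_def)
next
  assume v: "?v \<in> subdifferential g x"
  obtain gx where gx: "g x = ereal gx" using subdifferential_finite[OF v] by auto
  have "LS_objective \<Phi> g b \<mu> x \<le> LS_objective \<Phi> g b \<mu> z" for z
  proof -
    have "1 / (2 * \<mu>) * (norm (\<Phi> (z - x)))\<^sup>2 \<ge> 0" using mu by simp
    then have "1 / (2 * \<mu>) * (norm (\<Phi> x - b))\<^sup>2 + gx
        \<le> 1 / (2 * \<mu>) * (norm (\<Phi> z - b))\<^sup>2 + (gx + ?v \<bullet> (z - x))"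
      using norm_residual_expand[OF lin, of \<mu> z b x] by linarith
    then have "LS_objective \<Phi> g b \<mu> x
        \<le> ereal (1 / (2 * \<mu>) * (norm (\<Phi> z - b))\<^sup>2) + (g x + ereal (?v \<bullet> (z - x)))"
      by (simp add: LS_objective_def gx)
    also have "\<dots> \<le> LS_objective \<Phi> g b \<mu> z"
      unfolding LS_objective_def by (intro add_left_mono subdifferential_ineq[OF v])
    finally show ?thesis .
  qed
  then show "x \<in> S_LS \<Phi> g b \<mu>" by (simp add: S_LS_iff)
qed

section \<open>The subdifferential of the conjugate\<close>

lemma lsc_fun_closed_epigraph:
  fixes \<phi> :: "'a::metric_space \<Rightarrow> ereal"
  assumes "lsc_fun \<phi>"
  shows "closed {(x, r::real). \<phi> x \<le> ereal r}"
  unfolding closed_sequential_limits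
proof (intro allI impI)
  fix X :: "nat \<Rightarrow> 'a \<times> real" and l
  assume X: "(\<forall>n. X n \<in> {(x, r). \<phi> x \<le> ereal r}) \<and> X \<longlonglongrightarrow> l"
  obtain x r where l: "l = (x, r)" by fastforce
  have lim: "(\<lambda>n. fst (X n)) \<longlonglongrightarrow> x" "(\<lambda>n. snd (X n)) \<longlonglongrightarrow> r"
    using X l tendsto_fst[of X "(x, r)"] tendsto_snd[of X "(x, r)"] by auto
  have "\<phi> x \<le> ereal r"
  proof (rule ccontr)
    assume "\<not> \<phi> x \<le> ereal r"
    then obtain s where s: "ereal r < ereal s" "ereal s < \<phi> x"
      using ereal_dense2[of "ereal r" "\<phi> x"] by (auto simp: not_le)
    have "\<phi> x \<le> Liminf (nhds x) \<phi>" using assms by (simp add: lsc_fun_def)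
    then have "\<forall>\<^sub>F y in nhds x. ereal s < \<phi> y"
      using s(2) by (auto simp: le_Liminf_iff)
    then have "\<forall>\<^sub>F n in sequentially. ereal s < \<phi> (fst (X n))"
      using lim(1) by (rule eventually_compose_filterlim)
    moreover have "\<forall>\<^sub>F n in sequentially. snd (X n) < s"
      using lim(2) s(1) by (intro order_tendstoD) auto
    ultimately have "\<forall>\<^sub>F n in sequentially. False"
    proof eventually_elim
      case (elim n)
      have "\<phi> (fst (X n)) \<le> ereal (snd (X n))" using X by (auto simp: case_prod_beta)
      with elim have "ereal s < ereal (snd (X n))" by (blast intro: less_le_trans)
      with elim show False by simp
    qed
    then show False by simp
  qed
  then show "l \<in> {(x, r). \<phi> x \<le> ereal r}" by (simp add: l)
qed

text \<open>
  A point of \<open>S_LS id g a 1\<close> is a proximal point of \<open>g\<close> at \<open>a\<close>. Minimising over the epigraph replaces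
  the extended-valued lower semicontinuous objective by the continuous real function \<open>q\<close> on a closed
  set. The affine minorant that a single subgradient provides makes \<open>q\<close> coercive there, so its
  sublevel sets are compact.
\<close>

lemma prox_exists:
  fixes g :: "'a::euclidean_space \<Rightarrow> ereal"
  assumes lsc: "lsc_fun g" and v: "v \<in> subdifferential g u"
  obtains p where "p \<in> S_LS id g a 1"
proof -
  obtain gu where gu: "g u = ereal gu" using subdifferential_finite[OF v] by auto
  define q :: "'a \<times> real \<Rightarrow> real" where "q = (\<lambda>(x, r). 1/2 * (norm (x - a))\<^sup>2 + r)"
  define K where "K = {(x, r). g x \<le> ereal r} \<inter> {w. q w \<le> q (u, gu)}"
  have contq: "continuous_on UNIV q"
    unfolding q_def case_prod_beta by (intro continuous_intros)
  have "closed K"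
    unfolding K_def
    by (intro closed_Int lsc_fun_closed_epigraph lsc closed_Collect_le contq continuous_intros)
  moreover have "bounded K"
  proof -
    \<comment> \<open>Completing the square in the quadratic term plus the affine minorant centres the sublevel
      set at \<open>a - v\<close> with radius \<open>C\<close>; then \<open>- B\<close> bounds the minorant from below on that ball.\<close>
    define C where "C = sqrt (2 * (q (u, gu) - gu - v \<bullet> (a - u)) + (norm v)\<^sup>2)"
    define B where "B = \<bar>gu\<bar> + norm v * (C + norm (a - v) + norm u)"
    have "K \<subseteq> cball (a - v) C \<times> {- B .. q (u, gu)}"
    proof safe
      fix x r assume "(x, r) \<in> K"
      then have 1: "g x \<le> ereal r" and 2: "1/2 * (norm (x - a))\<^sup>2 + r \<le> q (u, gu)"
        by (auto simp: K_def q_def)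
      have "ereal gu + ereal (v \<bullet> (x - u)) \<le> ereal r"
        using order_trans[OF subdifferential_ineq[OF v, of x] 1] gu by simp
      then have 3: "gu + v \<bullet> (x - u) \<le> r" by simp
      have "(norm (x - (a - v)))\<^sup>2 = (norm (x - a))\<^sup>2 + 2 * (v \<bullet> (x - a)) + (norm v)\<^sup>2"
        by (simp add: power2_norm_eq_inner inner_diff inner_add inner_commute algebra_simps)
      moreover have "v \<bullet> (x - a) = v \<bullet> (x - u) - v \<bullet> (a - u)" by (simp add: inner_diff)
      moreover have "(norm (x - a))\<^sup>2 + 2 * (v \<bullet> (x - u)) \<le> 2 * (q (u, gu) - gu)"
        using 2 3 by argo
      ultimately have "(norm (x - (a - v)))\<^sup>2 \<le> 2 * (q (u, gu) - gu - v \<bullet> (a - u)) + (norm v)\<^sup>2"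
        by argo
      then have 4: "norm (x - (a - v)) \<le> C" unfolding C_def by (rule real_le_rsqrt)
      then show "x \<in> cball (a - v) C" by (simp add: dist_norm norm_minus_commute)
      have "norm (x - u) \<le> norm (x - (a - v)) + norm (a - v) + norm u"
        by norm
      then have "norm v * norm (x - u) \<le> norm v * (C + norm (a - v) + norm u)"
        using 4 by (intro mult_left_mono) auto
      moreover have "- (norm v * norm (x - u)) \<le> v \<bullet> (x - u)"
        using Cauchy_Schwarz_ineq2[of v "x - u"] by linarith
      ultimately have "- B \<le> r" using 3 unfolding B_def by linarith
      moreover have "r \<le> q (u, gu)" using 2 zero_le_power2[of "norm (x - a)"] by linarith
      ultimately show "r \<in> {- B .. q (u, gu)}" by simp
    qed
    then show ?thesis
      by (rule bounded_subset[rotated]) (intro bounded_Times bounded_cball bounded_closed_interval)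
  qed
  ultimately have "compact K" by (simp add: compact_eq_bounded_closed)
  moreover have "(u, gu) \<in> K" by (simp add: K_def gu)
  ultimately obtain w where w: "w \<in> K" "\<forall>w'\<in>K. q w \<le> q w'"
    using continuous_attains_inf[of K q] continuous_on_subset[OF contq] by blast
  obtain p r where pr: "w = (p, r)" by fastforce
  have min: "1/2 * (norm (p - a))\<^sup>2 + r \<le> 1/2 * (norm (x - a))\<^sup>2 + s" if "g x \<le> ereal s" for x s
  proof (cases "(x, s) \<in> K")
    case True
    then show ?thesis using w(2) pr by (fastforce simp: q_def)
  next
    case False
    then have "q (u, gu) < q (x, s)" using that by (simp add: K_def)
    moreover have "q w \<le> q (u, gu)" using w(1) by (simp add: K_def)
    ultimately show ?thesis by (simp add: q_def pr)
  qed
  have gp: "g p \<le> ereal r" using w(1) pr by (simp add: K_def)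
  have "LS_objective id g a 1 p \<le> LS_objective id g a 1 x" for x
  proof -
    have "LS_objective id g a 1 p \<le> ereal (1/2 * (norm (p - a))\<^sup>2 + r)"
      unfolding LS_objective_def using gp by (cases "g p") auto
    also have "\<dots> \<le> LS_objective id g a 1 x"
    proof (cases "g x")
      case (real s)
      then show ?thesis using min[of x s] by (simp add: LS_objective_def)
    next
      case MInf
      then show ?thesis using subdifferential_ineq[OF v, of x] gu by simp
    qed (simp add: LS_objective_def)
    finally show ?thesis .
  qed
  then have "p \<in> S_LS id g a 1" by (simp add: S_LS_iff)
  then show ?thesis by (rule that)
qed

lemma fenchel_conjugate_ge: "ereal (y \<bullet> x) - \<phi> x \<le> fenchel_conjugate \<phi> y"
  unfolding fenchel_conjugate_def by (rule SUP_upper) simp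

text \<open>The equality case of the Fenchel--Young inequality.\<close>

lemma fenchel_conjugate_eq:
  assumes "v \<in> subdifferential \<phi> u"
  shows "fenchel_conjugate \<phi> v = ereal (v \<bullet> u) - \<phi> u"
proof (rule antisym)
  obtain r where r: "\<phi> u = ereal r" using subdifferential_finite[OF assms] by auto
  show "fenchel_conjugate \<phi> v \<le> ereal (v \<bullet> u) - \<phi> u"
    unfolding fenchel_conjugate_def
  proof (rule SUP_least)
    fix x
    show "ereal (v \<bullet> x) - \<phi> x \<le> ereal (v \<bullet> u) - \<phi> u"
      using subdifferential_ineq[OF assms, of x] r by (cases "\<phi> x") (auto simp: inner_diff)
  qed
qed (rule fenchel_conjugate_ge)

text \<open>
  For the inclusion from left to right a proximal point takes the place of the biconjugate
  theorem. If \<open>z\<close> is a subgradient of the conjugate at \<open>v\<close>, let \<open>p\<close> be the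
  proximal point of \<open>g\<close> at \<open>z + v\<close>, so that \<open>y = z + v - p\<close> is a subgradient of \<open>g\<close> at \<open>p\<close>.
  Comparing the conjugate at \<open>v\<close> and at \<open>y\<close> gives \<open>(y - v) \<bullet> (p - z) \<ge> 0\<close>, and here
  \<open>y - v = z - p\<close>, whence \<open>p = z\<close> and \<open>y = v\<close>.
\<close>

lemma subdifferential_fenchel_conjugate:
  fixes g :: "'a::euclidean_space \<Rightarrow> ereal"
  assumes proper: "proper_fun g" and lsc: "lsc_fun g" and conv: "convex_fun g"
    and v: "v \<in> subdifferential g u"
  shows "subdifferential (fenchel_conjugate g) v = {z. v \<in> subdifferential g z}"
proof safe
  fix z assume z: "z \<in> subdifferential (fenchel_conjugate g) v"
  obtain p where p: "p \<in> S_LS id g (z + v) 1"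
    using prox_exists[OF lsc v] .
  have "adjoint id = (id :: 'a \<Rightarrow> 'a)" by (rule adjoint_unique) simp
  then have y: "z + v - p \<in> subdifferential g p" (is "?y \<in> _")
    using p S_LS_iff_subdifferential[OF linear_id proper conv, of 1 p "z + v"] by simp
  obtain gp where gp: "g p = ereal gp" using subdifferential_finite[OF y] by auto
  obtain c where c: "fenchel_conjugate g v = ereal c" using subdifferential_finite[OF z] by auto
  have "v \<bullet> p - gp \<le> c" using fenchel_conjugate_ge[of v p g] gp c by simp
  moreover have "c + z \<bullet> (?y - v) \<le> ?y \<bullet> p - gp"
    using subdifferential_ineq[OF z, of ?y] c gp fenchel_conjugate_eq[OF y] by simp
  ultimately have "(z - p) \<bullet> (z - p) \<le> 0"
    by (simp add: inner_diff inner_add inner_commute algebra_simps)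
  then have "z = p" by (metis inner_gt_zero_iff not_le right_minus_eq)
  then show "v \<in> subdifferential g z" using y by simp
next
  fix z assume z: "v \<in> subdifferential g z"
  obtain gz where gz: "g z = ereal gz" using subdifferential_finite[OF z] by auto
  have c: "fenchel_conjugate g v = ereal (v \<bullet> z - gz)"
    using fenchel_conjugate_eq[OF z] gz by simp
  have "fenchel_conjugate g v + ereal (z \<bullet> (y - v)) \<le> fenchel_conjugate g y" for y
    using fenchel_conjugate_ge[of y z g] by (simp add: c gz inner_diff inner_commute)
  then show "z \<in> subdifferential (fenchel_conjugate g) v"
    using c by (simp add: subdifferential_def)
qed

section \<open>Tangent directions in the kernel\<close>

text \<open>
  Replacing points at distance \<open>o(t)\<close> from \<open>D\<close> by almost nearest points of \<open>D\<close> perturbs the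
  directions by \<open>o(1)\<close> only. Almost nearest points, within an extra \<open>t / (k + 1)\<close>, exist for
  every nonempty \<open>D\<close>.
\<close>

lemma tangent_cone_if_infdist:
  fixes x :: "'a::real_normed_vector"
  assumes t: "\<And>k. t k > 0" "t \<longlonglongrightarrow> 0" and ws: "ws \<longlonglongrightarrow> w" and ne: "D \<noteq> {}"
    and inf: "(\<lambda>k. infdist (x + t k *\<^sub>R ws k) D / t k) \<longlonglongrightarrow> 0"
  shows "w \<in> tangent_cone D x"
proof -
  have "\<exists>z\<in>D. dist (x + t k *\<^sub>R ws k) z < infdist (x + t k *\<^sub>R ws k) D + t k * inverse (Suc k)"
    for k
  proof -
    have "(INF z\<in>D. dist (x + t k *\<^sub>R ws k) z) < infdist (x + t k *\<^sub>R ws k) D + t k * inverse (Suc k)"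
      using t(1)[of k] ne by (simp add: infdist_notempty)
    then show ?thesis using ne by (subst (asm) cINF_less_iff) auto
  qed
  then obtain z where z: "\<And>k. z k \<in> D"
    "\<And>k. dist (x + t k *\<^sub>R ws k) (z k) < infdist (x + t k *\<^sub>R ws k) D + t k * inverse (Suc k)"
    by metis
  define ws' where "ws' k = (z k - x) /\<^sub>R t k" for k
  have zeq: "x + t k *\<^sub>R ws' k = z k" for k using t(1)[of k] by (simp add: ws'_def)
  have "dist (ws' k) (ws k) \<le> infdist (x + t k *\<^sub>R ws k) D / t k + inverse (Suc k)" for k
  proof -
    have "t k * dist (ws' k) (ws k) = dist (x + t k *\<^sub>R ws k) (x + t k *\<^sub>R ws' k)"
      using t(1)[of k]
      by (simp add: dist_norm scaleR_diff_right[symmetric] norm_minus_commute)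
    also have "\<dots> \<le> t k * (infdist (x + t k *\<^sub>R ws k) D / t k + inverse (Suc k))"
      using z(2)[of k] t(1)[of k] by (simp add: zeq distrib_left)
    finally show ?thesis using t(1)[of k] by simp
  qed
  moreover have "(\<lambda>k. infdist (x + t k *\<^sub>R ws k) D / t k + inverse (Suc k)) \<longlonglongrightarrow> 0 + 0"
    by (intro tendsto_add inf LIMSEQ_inverse_real_of_nat)
  ultimately have "(\<lambda>k. dist (ws' k) (ws k)) \<longlonglongrightarrow> 0"
    by (intro tendsto_sandwich[of "\<lambda>_. 0" "\<lambda>k. dist (ws' k) (ws k)" sequentially
          "\<lambda>k. infdist (x + t k *\<^sub>R ws k) D / t k + inverse (Suc k)" 0]) auto
  then have "(\<lambda>k. ws' k - ws k) \<longlonglongrightarrow> 0" by (simp add: dist_norm tendsto_norm_zero_iff)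
  then have "ws' \<longlonglongrightarrow> w" using tendsto_add[OF _ ws] by fastforce
  then show ?thesis
    unfolding tangent_cone_def using t z(1) zeq by (intro CollectI exI[of _ t] exI[of _ ws']) auto
qed

text \<open>
  The error bound on \<open>D\<close> is homogeneous, so dividing it by the step length \<open>t\<close> and passing to the
  limit gives \<open>norm w \<le> C * norm (\<Phi> w)\<close> for every tangent direction \<open>w\<close>.
\<close>

lemma kernel_Int_tangent_cone_trivial:
  fixes \<Phi> :: "'a::euclidean_space \<Rightarrow> 'b::euclidean_space"
  assumes lin: "linear \<Phi>" and x: "x \<in> D" and "\<delta> > 0"
    and bnd: "\<And>z. z \<in> D \<Longrightarrow> norm (z - x) < \<delta> \<Longrightarrow> norm (z - x) \<le> C * norm (\<Phi> (z - x))"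
  shows "\<Phi> -` {0} \<inter> tangent_cone D x = {0}"
proof (intro equalityI subsetI)
  fix w assume "w \<in> \<Phi> -` {0} \<inter> tangent_cone D x"
  then have 0: "\<Phi> w = 0" and "w \<in> tangent_cone D x" by auto
  then obtain t ws where t: "\<And>k. t k > (0::real)" "t \<longlonglongrightarrow> 0" and ws: "ws \<longlonglongrightarrow> w"
    and D: "\<And>k. x + t k *\<^sub>R ws k \<in> D"
    unfolding tangent_cone_def by auto
  have cont: "isCont \<Phi> w"
    using lin by (intro linear_continuous_at linear_conv_bounded_linear[THEN iffD1])
  have lim: "(\<lambda>k. C * norm (\<Phi> (ws k))) \<longlonglongrightarrow> C * norm (\<Phi> w)"
    by (intro tendsto_intros isCont_tendsto_compose[OF cont] ws)
  have "(\<lambda>k. norm (t k *\<^sub>R ws k)) \<longlonglongrightarrow> norm (0 *\<^sub>R w)"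
    by (intro tendsto_intros t ws)
  then have "\<forall>\<^sub>F k in sequentially. norm (t k *\<^sub>R ws k) < \<delta>"
    using \<open>\<delta> > 0\<close> by (intro order_tendstoD) auto
  then have "\<forall>\<^sub>F k in sequentially. norm (ws k) \<le> C * norm (\<Phi> (ws k))"
  proof eventually_elim
    case (elim k)
    then have "t k * norm (ws k) \<le> t k * (C * norm (\<Phi> (ws k)))"
      using bnd[OF D[of k]] t(1)[of k] by (simp add: linear_scale[OF lin] algebra_simps)
    then show ?case using t(1)[of k] by simp
  qed
  then have "norm w \<le> C * norm (\<Phi> w)"
    by (intro tendsto_le[OF _ lim tendsto_norm[OF ws]]) auto
  then show "w \<in> {0}" by (simp add: 0)
next
  fix w :: 'a assume "w \<in> {0}"
  moreover have "\<Phi> 0 = 0" using lin by (simp add: linear_0)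
  moreover have "0 \<in> tangent_cone D x"
    unfolding tangent_cone_def
    using x LIMSEQ_inverse_real_of_nat
    by (intro CollectI exI[of _ "\<lambda>n. inverse (real (Suc n))"] exI[of _ "\<lambda>_. 0"]) auto
  ultimately show "w \<in> \<Phi> -` {0} \<inter> tangent_cone D x" by simp
qed

text \<open>
  Calmness is tested only with perturbations of \<open>b\<close>: a point \<open>z\<close> at which \<open>y\<close> is a subgradient
  solves the problem with datum \<open>b + \<Phi> (z - x)\<close>, since its residual equals that of \<open>x\<close>.
\<close>

lemma kernel_trivial_if_isolated_calm:
  fixes \<Phi> :: "'a::euclidean_space \<Rightarrow> 'b::euclidean_space"
  assumes lin: "linear \<Phi>" and proper: "proper_fun g" and conv: "convex_fun g"
    and mu: "\<mu> > 0" and y: "y = - (1 / \<mu>) *\<^sub>R adjoint \<Phi> (\<Phi> x - b)"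
    and yx: "y \<in> subdifferential g x"
    and calm: "isolated_calm (S_LS \<Phi> g) b \<mu> x"
  shows "\<Phi> -` {0} \<inter> tangent_cone {z. y \<in> subdifferential g z} x = {0}"
proof -
  obtain \<kappa> U V M where U: "open U" "x \<in> U" and V: "open V" "b \<in> V" and M: "\<mu> \<in> M"
    and calm': "\<forall>b'\<in>V. \<forall>\<mu>'\<in>M. \<forall>z \<in> S_LS \<Phi> g b' \<mu>' \<inter> U.
       norm (z - x) \<le> \<kappa> * (norm (b' - b) + \<bar>\<mu>' - \<mu>\<bar>)"
    using calm unfolding isolated_calm_def by (elim exE conjE) blast
  define b' where "b' z = b + \<Phi> (z - x)" for z
  have "continuous_on UNIV b'"
    unfolding b'_def
    by (intro continuous_on_add continuous_on_const linear_continuous_on_compose[OF _ lin]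
        continuous_on_diff continuous_on_id)
  then have "open (b' -` V)" using V(1) by (simp add: open_vimage)
  then have "open (U \<inter> b' -` V)" using U(1) by (rule open_Int[rotated])
  moreover have "x \<in> U \<inter> b' -` V" using U V lin by (simp add: b'_def linear_0)
  ultimately obtain \<delta> where \<delta>: "\<delta> > 0" "ball x \<delta> \<subseteq> U \<inter> b' -` V"
    by (rule openE)
  show ?thesis
  proof (rule kernel_Int_tangent_cone_trivial[OF lin _ \<delta>(1)])
    fix z assume z: "z \<in> {z. y \<in> subdifferential g z}" and near: "norm (z - x) < \<delta>"
    have "\<Phi> z - b' z = \<Phi> x - b" by (simp add: b'_def linear_diff[OF lin])
    then have "z \<in> S_LS \<Phi> g (b' z) \<mu>"
      using S_LS_iff_subdifferential[OF lin proper conv mu] z y by simp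
    moreover have "z \<in> U" "b' z \<in> V"
      using near \<delta>(2) by (auto simp: dist_norm norm_minus_commute subset_iff)
    ultimately show "norm (z - x) \<le> \<kappa> * norm (\<Phi> (z - x))"
      using calm'[rule_format, of "b' z" \<mu> z] M by (simp add: b'_def)
  qed (use yx in simp)
qed

text \<open>
  If \<open>y\<close> is a subgradient of \<open>g\<close> at \<open>z\<close> as well, \<open>g\<close> grows from \<open>x\<close> to \<open>z\<close> no faster than the linear
  function \<open>y\<close>, so the quadratic growth of the objective must come from the term
  \<open>(norm (\<Phi> (z - x)))\<^sup>2\<close>.
\<close>

lemma kernel_trivial_if_strong_solution:
  fixes \<Phi> :: "'a::euclidean_space \<Rightarrow> 'b::euclidean_space"
  assumes lin: "linear \<Phi>" and mu: "\<mu> > 0"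
    and y: "y = - (1 / \<mu>) *\<^sub>R adjoint \<Phi> (\<Phi> x - b)" and yx: "y \<in> subdifferential g x"
    and strong: "strong_solution (LS_objective \<Phi> g b \<mu>) x"
  shows "\<Phi> -` {0} \<inter> tangent_cone {z. y \<in> subdifferential g z} x = {0}"
proof -
  obtain c \<epsilon> where c: "c > 0" and \<epsilon>: "\<epsilon> > 0"
    and gr: "\<And>z. norm (z - x) < \<epsilon> \<Longrightarrow>
       LS_objective \<Phi> g b \<mu> x + ereal (c / 2 * (norm (z - x))\<^sup>2) \<le> LS_objective \<Phi> g b \<mu> z"
    using strong unfolding strong_solution_def by blast
  obtain gx where gx: "g x = ereal gx" using subdifferential_finite[OF yx] by auto
  show ?thesis
  proof (rule kernel_Int_tangent_cone_trivial[OF lin _ \<epsilon>])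
    fix z assume z: "z \<in> {z. y \<in> subdifferential g z}" and near: "norm (z - x) < \<epsilon>"
    then have yz: "y \<in> subdifferential g z" by simp
    obtain gz where gz: "g z = ereal gz" using subdifferential_finite[OF yz] by auto
    have "gz - gx - y \<bullet> (z - x) \<le> 0"
      using subdifferential_ineq[OF yz, of x] by (simp add: gx gz inner_diff)
    moreover have "c / 2 * (norm (z - x))\<^sup>2
        \<le> gz - gx - y \<bullet> (z - x) + 1 / (2 * \<mu>) * (norm (\<Phi> (z - x)))\<^sup>2"
      using gr[OF near] LS_objective_expand[where g = g, OF lin gx gz y]
      by (simp add: LS_objective_def gx)
    ultimately have "c / 2 * (norm (z - x))\<^sup>2 \<le> 1 / (2 * \<mu>) * (norm (\<Phi> (z - x)))\<^sup>2" by linarith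
    then have "(norm (z - x))\<^sup>2 \<le> 1 / (c * \<mu>) * (norm (\<Phi> (z - x)))\<^sup>2"
      using c mu by (simp add: field_simps)
    then have "sqrt ((norm (z - x))\<^sup>2) \<le> sqrt (1 / (c * \<mu>) * (norm (\<Phi> (z - x)))\<^sup>2)"
      by (rule real_sqrt_le_mono)
    then show "norm (z - x) \<le> sqrt (1 / (c * \<mu>)) * norm (\<Phi> (z - x))"
      by (simp only: real_sqrt_mult real_sqrt_abs abs_norm_cancel)
  qed (use yx in simp)
qed

section \<open>Strong solutions\<close>

text \<open>
  A sequence \<open>X\<close> along which strong optimality fails with growth constants \<open>e k\<close> tending to zero has
  normalised displacements \<open>ws\<close> that are asymptotically in the kernel and asymptotically tangent to
  \<open>D\<close>; the fact \<open>key\<close> bounds the squares of both defects by multiples of \<open>e k\<close>. Compactness of the unit sphere provides a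
  forbidden limit direction.
\<close>

lemma strong_solution_if_kernel_trivial:
  fixes \<Phi> :: "'a::euclidean_space \<Rightarrow> 'b::euclidean_space"
  assumes lin: "linear \<Phi>" and mu: "\<mu> > 0"
    and y: "y = - (1 / \<mu>) *\<^sub>R adjoint \<Phi> (\<Phi> x - b)" and yx: "y \<in> subdifferential g x"
    and qg: "quadratic_growth g x y"
    and ker: "\<Phi> -` {0} \<inter> tangent_cone {z. y \<in> subdifferential g z} x = {0}"
  shows "strong_solution (LS_objective \<Phi> g b \<mu>) x"
proof (rule ccontr)
  define D where "D = {z. y \<in> subdifferential g z}"
  assume "\<not> strong_solution (LS_objective \<Phi> g b \<mu>) x"
  then have neg: "\<exists>z. norm (z - x) < \<epsilon> \<and>
      LS_objective \<Phi> g b \<mu> z < LS_objective \<Phi> g b \<mu> x + ereal (c / 2 * (norm (z - x))\<^sup>2)"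
    if "c > 0" "\<epsilon> > 0" for c \<epsilon>
    using that unfolding strong_solution_def by (meson not_le)
  obtain c \<epsilon> where c: "c > 0" and \<epsilon>: "\<epsilon> > 0"
    and gr: "\<And>z. norm (z - x) < \<epsilon> \<Longrightarrow>
       g x + ereal (y \<bullet> (z - x)) + ereal (c / 2 * (infdist z D)\<^sup>2) \<le> g z"
    using qg unfolding quadratic_growth_def D_def by blast
  obtain gx where gx: "g x = ereal gx" using subdifferential_finite[OF yx] by auto
  define e where "e k = inverse (real (Suc k))" for k
  have e: "e k > 0" for k by (simp add: e_def)
  have elim0: "e \<longlonglongrightarrow> 0" unfolding e_def by (rule LIMSEQ_inverse_real_of_nat)
  obtain X where X: "\<And>k. norm (X k - x) < min \<epsilon> (e k)"
    "\<And>k. LS_objective \<Phi> g b \<mu> (X k) < LS_objective \<Phi> g b \<mu> x + ereal (e k / 2 * (norm (X k - x))\<^sup>2)"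
    using neg[OF e, of "min \<epsilon> (e k)" k for k] \<epsilon> e by (metis min_less_iff_conj)
  define t where "t k = norm (X k - x)" for k
  define ws where "ws k = (X k - x) /\<^sub>R t k" for k
  \<comment> \<open>The failure of strong optimality is a strict inequality, which is impossible at \<open>x\<close> itself.\<close>
  have tpos: "t k > 0" for k using X(2)[of k] by (auto simp: t_def)
  have Xeq: "x + t k *\<^sub>R ws k = X k" for k using tpos[of k] by (simp add: ws_def)
  have diff: "X k - x = t k *\<^sub>R ws k" for k using Xeq[of k] by (metis add_diff_cancel_left')
  have t0: "t \<longlonglongrightarrow> 0"
  proof (rule tendsto_sandwich[of "\<lambda>_. 0" t _ e])
    show "\<forall>\<^sub>F k in sequentially. t k \<le> e k"
      using X(1) by (intro always_eventually) (auto simp: t_def less_imp_le)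
  qed (use elim0 tpos in \<open>auto simp: less_imp_le\<close>)
  have key: "c * (infdist (X k) D / t k)\<^sup>2 + 1 / \<mu> * (norm (\<Phi> (ws k)))\<^sup>2 \<le> e k" for k
  proof -
    have near: "norm (X k - x) < \<epsilon>" using X(1)[of k] by simp
    obtain gz where gz: "g (X k) = ereal gz"
      using gr[OF near] X(2)[of k] by (cases "g (X k)") (auto simp: gx LS_objective_def)
    have "c / 2 * (infdist (X k) D)\<^sup>2 \<le> gz - gx - y \<bullet> (X k - x)"
      using gr[OF near] by (simp add: gx gz)
    moreover have "gz - gx - y \<bullet> (X k - x) + 1 / (2 * \<mu>) * (norm (\<Phi> (X k - x)))\<^sup>2
        < e k / 2 * (t k)\<^sup>2"
      using X(2)[of k] LS_objective_expand[where g = g, OF lin gx gz y]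
      by (simp add: LS_objective_def gx t_def)
    moreover have "norm (\<Phi> (X k - x)) = t k * norm (\<Phi> (ws k))"
      using tpos[of k] by (simp add: diff linear_scale[OF lin])
    ultimately have "c / 2 * (infdist (X k) D)\<^sup>2 + 1 / (2 * \<mu>) * (t k * norm (\<Phi> (ws k)))\<^sup>2
        \<le> e k / 2 * (t k)\<^sup>2" by simp
    moreover have "infdist (X k) D = t k * (infdist (X k) D / t k)" using tpos[of k] by simp
    ultimately have "c / 2 * (t k * (infdist (X k) D / t k))\<^sup>2
        + 1 / (2 * \<mu>) * (t k * norm (\<Phi> (ws k)))\<^sup>2 \<le> e k / 2 * (t k)\<^sup>2" by metis
    then have "(c * (infdist (X k) D / t k)\<^sup>2 + 1 / \<mu> * (norm (\<Phi> (ws k)))\<^sup>2) * (t k)\<^sup>2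
        \<le> e k * (t k)\<^sup>2"
      unfolding power_mult_distrib by (simp add: algebra_simps)
    then show ?thesis using tpos[of k] by simp
  qed
  have sq0: "f \<longlonglongrightarrow> 0" if a: "a > 0" and f: "\<And>k. 0 \<le> f k" "\<And>k. a * (f k)\<^sup>2 \<le> e k"
    for a :: real and f :: "nat \<Rightarrow> real"
  proof -
    have "(\<lambda>k. e k / a) \<longlonglongrightarrow> 0 / a" by (intro tendsto_intros elim0) (use a in simp)
    moreover have "(f k)\<^sup>2 \<le> e k / a" for k using f(2)[of k] a by (simp add: field_simps)
    ultimately have "(\<lambda>k. (f k)\<^sup>2) \<longlonglongrightarrow> 0"
      by (intro tendsto_sandwich[of "\<lambda>_. 0" "\<lambda>k. (f k)\<^sup>2" sequentially "\<lambda>k. e k / a" 0]) auto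
    then show ?thesis by simp
  qed
  have d0: "(\<lambda>k. infdist (X k) D / t k) \<longlonglongrightarrow> 0"
  proof (rule sq0[OF c])
    fix k
    have "0 \<le> 1 / \<mu> * (norm (\<Phi> (ws k)))\<^sup>2" using mu by simp
    then show "c * (infdist (X k) D / t k)\<^sup>2 \<le> e k" using key[of k] by linarith
  qed (use tpos in \<open>simp add: infdist_nonneg less_imp_le\<close>)
  have \<Phi>0: "(\<lambda>k. norm (\<Phi> (ws k))) \<longlonglongrightarrow> 0"
  proof (rule sq0[of "1 / \<mu>"])
    fix k
    have "0 \<le> c * (infdist (X k) D / t k)\<^sup>2" using c by simp
    then show "1 / \<mu> * (norm (\<Phi> (ws k)))\<^sup>2 \<le> e k" using key[of k] by linarith
  qed (use mu in simp_all)
  have "ws k \<in> sphere 0 1" for k using tpos[of k] by (simp add: ws_def t_def)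
  then obtain w r where w: "w \<in> sphere 0 1" and r: "strict_mono r" and lim: "(ws \<circ> r) \<longlonglongrightarrow> w"
    using compact_sphere[of "0::'a" 1] unfolding compact_def by metis
  have "isCont \<Phi> w"
    using lin by (intro linear_continuous_at linear_conv_bounded_linear[THEN iffD1])
  then have "(\<lambda>k. norm (\<Phi> ((ws \<circ> r) k))) \<longlonglongrightarrow> norm (\<Phi> w)"
    by (intro tendsto_intros isCont_tendsto_compose[of w \<Phi>] lim)
  moreover have "(\<lambda>k. norm (\<Phi> ((ws \<circ> r) k))) \<longlonglongrightarrow> 0"
    using LIMSEQ_subseq_LIMSEQ[OF \<Phi>0 r] by (simp add: o_def)
  ultimately have "norm (\<Phi> w) = 0" by (rule LIMSEQ_unique)
  moreover have "w \<in> tangent_cone D x"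
  proof (rule tangent_cone_if_infdist[OF _ _ lim])
    show "t (r k) > 0" for k by (rule tpos)
    show "(\<lambda>k. t (r k)) \<longlonglongrightarrow> 0" using LIMSEQ_subseq_LIMSEQ[OF t0 r] by (simp add: o_def)
    show "D \<noteq> {}" using yx by (auto simp: D_def)
    show "(\<lambda>k. infdist (x + t (r k) *\<^sub>R (ws \<circ> r) k) D / t (r k)) \<longlonglongrightarrow> 0"
      using LIMSEQ_subseq_LIMSEQ[OF d0 r] by (simp add: o_def Xeq)
  qed
  ultimately have "w \<in> {0}" using ker unfolding D_def by auto
  then show False using w by simp
qed

text \<open>
  Adding the growth of the objective at \<open>x\<close> to the optimality of \<open>z\<close> for the perturbed problem
  cancels \<open>g\<close> and leaves \<open>c / 2 * (norm (z - x))\<^sup>2\<close> bounded by the difference of two increments of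
  least squares terms. That difference is at most \<open>A\<close> times the perturbation times
  \<open>norm (z - x)\<close>, and one factor \<open>norm (z - x)\<close> cancels.
\<close>

lemma isolated_calm_if_strong_solution:
  fixes \<Phi> :: "'a::euclidean_space \<Rightarrow> 'b::euclidean_space"
  assumes lin: "linear \<Phi>" and proper: "proper_fun g" and mu: "\<mu> > 0"
    and fin: "\<bar>g x\<bar> \<noteq> \<infinity>"
    and strong: "strong_solution (LS_objective \<Phi> g b \<mu>) x"
  shows "isolated_calm (S_LS \<Phi> g) b \<mu> x"
proof -
  obtain c \<epsilon> where c: "c > 0" and \<epsilon>: "\<epsilon> > 0"
    and gr: "\<And>z. norm (z - x) < \<epsilon> \<Longrightarrow>
       LS_objective \<Phi> g b \<mu> x + ereal (c / 2 * (norm (z - x))\<^sup>2) \<le> LS_objective \<Phi> g b \<mu> z"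
    using strong unfolding strong_solution_def by blast
  obtain gx where gx: "g x = ereal gx" using fin by auto
  obtain L where L: "L > 0" "\<And>z. norm (\<Phi> z) \<le> L * norm z"
    using linear_bounded_pos[OF lin] by blast
  define R where "R = norm (\<Phi> x - b)"
  \<comment> \<open>The summands of \<open>A\<close> bound, in this order, the effect of changing \<open>b\<close>, the effect of changing
    \<open>\<mu>\<close> on the linear part and its effect on the quadratic part, on \<open>ball x \<epsilon>\<close> and for perturbed
    parameters above \<open>\<mu> / 2\<close>.\<close>
  define A where "A = 2 * L / \<mu> + 2 * R * L / \<mu>\<^sup>2 + L\<^sup>2 * \<epsilon> / \<mu>\<^sup>2"
  define \<kappa> where "\<kappa> = 2 * A / c"
  have R: "R \<ge> 0" by (simp add: R_def)
  have A: "A > 0" unfolding A_def using L mu \<epsilon> R by (intro add_pos_nonneg) auto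
  have main: "norm (z - x) \<le> \<kappa> * (norm (b' - b) + \<bar>\<mu>' - \<mu>\<bar>)"
    if \<mu>': "\<mu>' > \<mu> / 2" and z: "z \<in> S_LS \<Phi> g b' \<mu>'" and near: "norm (z - x) < \<epsilon>" for b' \<mu>' z
  proof -
    define d where "d = z - x"
    have \<mu>'0: "\<mu>' > 0" using \<mu>' mu by linarith
    obtain gz where gz: "g z = ereal gz" using S_LS_finite[OF proper z] by auto
    have zx: "\<Phi> z - \<beta> = (\<Phi> x - \<beta>) + \<Phi> d" for \<beta> by (simp add: d_def linear_diff[OF lin])
    have ex: "(norm (\<Phi> z - \<beta>))\<^sup>2 = (norm (\<Phi> x - \<beta>))\<^sup>2 + 2 * ((\<Phi> x - \<beta>) \<bullet> \<Phi> d) + (norm (\<Phi> d))\<^sup>2"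
      for \<beta> unfolding zx by (simp only: power2_norm_eq_inner) (simp add: inner_add inner_commute)
    have "LS_objective \<Phi> g b' \<mu>' z \<le> LS_objective \<Phi> g b' \<mu>' x" using z by (rule S_LS_le)
    then have 1: "1 / (2 * \<mu>') * (norm (\<Phi> z - b'))\<^sup>2 + gz \<le> 1 / (2 * \<mu>') * (norm (\<Phi> x - b'))\<^sup>2 + gx"
      by (simp add: LS_objective_def gx gz)
    have 2: "1 / (2 * \<mu>) * (norm (\<Phi> x - b))\<^sup>2 + gx + c / 2 * (norm d)\<^sup>2
        \<le> 1 / (2 * \<mu>) * (norm (\<Phi> z - b))\<^sup>2 + gz"
      using gr[OF near] by (simp add: LS_objective_def gx gz d_def)
    have 3: "1 / (2 * \<nu>) * (norm (\<Phi> z - \<beta>))\<^sup>2 = 1 / (2 * \<nu>) * (norm (\<Phi> x - \<beta>))\<^sup>2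
        + 1 / \<nu> * ((\<Phi> x - \<beta>) \<bullet> \<Phi> d) + 1 / (2 * \<nu>) * (norm (\<Phi> d))\<^sup>2" for \<nu> \<beta>
      unfolding ex by (simp add: algebra_simps)
    define s where "s = 1 / \<mu> - 1 / \<mu>'"
    have "c / 2 * (norm d)\<^sup>2 \<le> 1 / \<mu> * ((\<Phi> x - b) \<bullet> \<Phi> d) + 1 / (2 * \<mu>) * (norm (\<Phi> d))\<^sup>2
        - (1 / \<mu>' * ((\<Phi> x - b') \<bullet> \<Phi> d) + 1 / (2 * \<mu>') * (norm (\<Phi> d))\<^sup>2)"
      using 1 2 unfolding 3[of \<mu>] 3[of \<mu>'] by linarith
    also have "\<dots> = 1 / \<mu>' * ((b' - b) \<bullet> \<Phi> d) + s * ((\<Phi> x - b) \<bullet> \<Phi> d) + s / 2 * (norm (\<Phi> d))\<^sup>2"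
      by (simp add: s_def algebra_simps inner_diff_left diff_divide_distrib)
    also have "\<dots> \<le> 2 / \<mu> * (norm (b' - b) * (L * norm d)) + \<bar>s\<bar> * (R * (L * norm d))
        + \<bar>s\<bar> / 2 * (L\<^sup>2 * \<epsilon> * norm d)"
    proof (intro add_mono)
      have "1 / \<mu>' \<le> 2 / \<mu>" using \<mu>' mu \<mu>'0 by (simp add: field_simps)
      moreover have "(b' - b) \<bullet> \<Phi> d \<le> norm (b' - b) * (L * norm d)"
        using norm_cauchy_schwarz[of "b' - b" "\<Phi> d"] mult_left_mono[OF L(2)[of d], of "norm (b' - b)"]
        by simp
      ultimately show "1 / \<mu>' * ((b' - b) \<bullet> \<Phi> d) \<le> 2 / \<mu> * (norm (b' - b) * (L * norm d))"
        using mu \<mu>'0 L(1)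
        by (meson mult_left_mono mult_right_mono order_trans divide_nonneg_pos mult_nonneg_nonneg
            norm_ge_zero less_imp_le zero_le_one)
      have "s * ((\<Phi> x - b) \<bullet> \<Phi> d) \<le> \<bar>s\<bar> * \<bar>(\<Phi> x - b) \<bullet> \<Phi> d\<bar>"
        by (metis abs_ge_self abs_mult)
      also have "\<dots> \<le> \<bar>s\<bar> * (R * (L * norm d))"
        using Cauchy_Schwarz_ineq2[of "\<Phi> x - b" "\<Phi> d"] mult_left_mono[OF L(2)[of d] R]
        by (intro mult_left_mono) (auto simp: R_def)
      finally show "s * ((\<Phi> x - b) \<bullet> \<Phi> d) \<le> \<bar>s\<bar> * (R * (L * norm d))" .
      have "(norm (\<Phi> d))\<^sup>2 \<le> (L * norm d)\<^sup>2" using L(2)[of d] by (intro power_mono) auto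
      also have "\<dots> = L\<^sup>2 * norm d * norm d" by (simp add: power2_eq_square)
      also have "\<dots> \<le> L\<^sup>2 * \<epsilon> * norm d"
        using near by (intro mult_right_mono mult_left_mono) (auto simp: d_def)
      finally have "(norm (\<Phi> d))\<^sup>2 \<le> L\<^sup>2 * \<epsilon> * norm d" .
      moreover have "s / 2 * (norm (\<Phi> d))\<^sup>2 \<le> \<bar>s\<bar> / 2 * (norm (\<Phi> d))\<^sup>2"
        by (intro mult_right_mono) auto
      ultimately show "s / 2 * (norm (\<Phi> d))\<^sup>2 \<le> \<bar>s\<bar> / 2 * (L\<^sup>2 * \<epsilon> * norm d)"
        by (meson mult_left_mono order_trans abs_ge_zero divide_nonneg_pos zero_less_numeral)
    qed
    also have "\<dots> = (2 * L / \<mu> * norm (b' - b) + \<bar>s\<bar> * (R * L + L\<^sup>2 * \<epsilon> / 2)) * norm d"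
      by (simp add: algebra_simps)
    also have "\<dots> \<le> (A * (norm (b' - b) + \<bar>\<mu>' - \<mu>\<bar>)) * norm d"
    proof (intro mult_right_mono)
      have "s = (\<mu>' - \<mu>) / (\<mu> * \<mu>')" using mu \<mu>'0 by (simp add: s_def field_simps)
      then have "\<bar>s\<bar> = \<bar>\<mu>' - \<mu>\<bar> / (\<mu> * \<mu>')" using mu \<mu>'0 by (simp add: abs_mult)
      also have "\<dots> \<le> \<bar>\<mu>' - \<mu>\<bar> / (\<mu> * (\<mu> / 2))"
        using mu \<mu>' \<mu>'0 by (intro divide_left_mono mult_left_mono) auto
      finally have "\<bar>s\<bar> \<le> 2 / \<mu>\<^sup>2 * \<bar>\<mu>' - \<mu>\<bar>" by (simp add: power2_eq_square mult.commute)
      then have "\<bar>s\<bar> * (R * L + L\<^sup>2 * \<epsilon> / 2) \<le> 2 / \<mu>\<^sup>2 * \<bar>\<mu>' - \<mu>\<bar> * (R * L + L\<^sup>2 * \<epsilon> / 2)"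
        using R L(1) \<epsilon> by (intro mult_right_mono) auto
      also have "\<dots> = (2 * R * L / \<mu>\<^sup>2 + L\<^sup>2 * \<epsilon> / \<mu>\<^sup>2) * \<bar>\<mu>' - \<mu>\<bar>"
        by (simp add: algebra_simps add_divide_distrib)
      also have "\<dots> \<le> A * \<bar>\<mu>' - \<mu>\<bar>"
        unfolding A_def using L(1) mu by (intro mult_right_mono) auto
      finally have i: "\<bar>s\<bar> * (R * L + L\<^sup>2 * \<epsilon> / 2) \<le> A * \<bar>\<mu>' - \<mu>\<bar>" .
      have "2 * L / \<mu> \<le> A" unfolding A_def using L(1) R \<epsilon> by simp
      then have "2 * L / \<mu> * norm (b' - b) \<le> A * norm (b' - b)" by (intro mult_right_mono) auto
      with i show "2 * L / \<mu> * norm (b' - b) + \<bar>s\<bar> * (R * L + L\<^sup>2 * \<epsilon> / 2)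
          \<le> A * (norm (b' - b) + \<bar>\<mu>' - \<mu>\<bar>)"
        by (simp add: distrib_left)
    qed simp
    finally have fin': "c / 2 * norm d * norm d \<le> (A * (norm (b' - b) + \<bar>\<mu>' - \<mu>\<bar>)) * norm d"
      by (simp add: power2_eq_square)
    have "c / 2 * norm d \<le> A * (norm (b' - b) + \<bar>\<mu>' - \<mu>\<bar>)"
    proof (cases "d = 0")
      case False
      then show ?thesis by (intro mult_right_le_imp_le[OF fin']) simp
    qed (use A in simp)
    then show ?thesis using c by (simp add: \<kappa>_def d_def field_simps)
  qed
  have "norm (z - x) \<le> \<kappa> * (norm (b' - b) + \<bar>\<mu>' - \<mu>\<bar>)"
    if "\<mu>' \<in> {\<mu> / 2<..}" "z \<in> S_LS \<Phi> g b' \<mu>' \<inter> ball x \<epsilon>" for b' \<mu>' z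
    using that by (intro main) (auto simp: dist_norm norm_minus_commute)
  moreover have "\<kappa> > 0" using A c by (simp add: \<kappa>_def)
  moreover have "{\<mu> / 2<..} \<subseteq> {0<..}" "\<mu> \<in> {\<mu> / 2<..}" using mu by auto
  moreover have "x \<in> ball x \<epsilon>" using \<epsilon> by simp
  ultimately show ?thesis
    unfolding isolated_calm_def
    by (intro exI[of _ \<kappa>] exI[of _ "ball x \<epsilon>"] exI[of _ UNIV] exI[of _ "{\<mu> / 2<..}"] conjI ballI)
      (blast | simp)+
qed

section \<open>The equivalence\<close>

theorem corollary4p4:
  fixes \<Phi> :: "'x::euclidean_space \<Rightarrow> 'e::euclidean_space"
    and g :: "'x \<Rightarrow> ereal"
    and b\<^sub>0 :: 'e and \<mu>\<^sub>0 :: real and x\<^sub>0 y\<^sub>0 :: 'x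
  assumes "linear \<Phi>"
    and "proper_fun g" and "lsc_fun g" and "convex_fun g"
    and "\<mu>\<^sub>0 > 0"
    and "x\<^sub>0 \<in> S_LS \<Phi> g b\<^sub>0 \<mu>\<^sub>0"
    and "y\<^sub>0 = - (1 / \<mu>\<^sub>0) *\<^sub>R adjoint \<Phi> (\<Phi> x\<^sub>0 - b\<^sub>0)"
    and "quadratic_growth g x\<^sub>0 y\<^sub>0"
  shows "(isolated_calm (S_LS \<Phi> g) b\<^sub>0 \<mu>\<^sub>0 x\<^sub>0
            \<longleftrightarrow> strong_solution (LS_objective \<Phi> g b\<^sub>0 \<mu>\<^sub>0) x\<^sub>0)
       \<and> (strong_solution (LS_objective \<Phi> g b\<^sub>0 \<mu>\<^sub>0) x\<^sub>0
            \<longleftrightarrow> \<Phi> -` {0} \<inter> tangent_cone (subdifferential (fenchel_conjugate g) y\<^sub>0) x\<^sub>0 = {0})"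
proof -
  have y: "y\<^sub>0 \<in> subdifferential g x\<^sub>0"
    using S_LS_iff_subdifferential[of \<Phi> g \<mu>\<^sub>0 x\<^sub>0 b\<^sub>0] assms by simp
  show ?thesis
    unfolding subdifferential_fenchel_conjugate[OF assms(2-4) y]
    using kernel_trivial_if_isolated_calm[OF assms(1,2,4,5,7) y]
      kernel_trivial_if_strong_solution[OF assms(1,5,7) y]
      strong_solution_if_kernel_trivial[OF assms(1,5,7) y assms(8)]
      isolated_calm_if_strong_solution[OF assms(1,2,5) S_LS_finite[OF assms(2,6)], of b\<^sub>0]
    by blast
qed

end
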